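(* Let $AX=B$, where all entries of $X\in\mathbb{R}^{n\times m}$ are nonzero, $A\in\mathbb{R}^{n\times n}$ is a nonsingular $\{1;1\}$-quasiseparable matrix with a quasiseparable representation $\Omega_{QS}$, and $B=\sum_{k=1}^M\omega_k^BS_k\in\mathbb{R}^{n\times m}$ has a sparse representation with parameter vector $\Omega_B=(\omega_1^B,\dots,\omega_M^B)$. Let $\Omega_{QS}\cap\Omega_B=\emptyset$ (the parameters of $A$ and of $B$ are independent). Then $$\mathscr{K}_{\rm eff}(A(\Omega_{QS}),B(\Omega_B))\le\mathscr{K}^{QS}_{|\Omega_B|}\le(n-1)\,\mathscr{K}_{\rm eff}(A(\Omega_{QS}),B(\Omega_B)).$$
   Context: Let $n\ge2$. A quasiseparable representation of a $\{1;1\}$-quasiseparable matrix $A\in\mathbb{R}^{n\times n}$ is a vector of $7n-8$ real parameters $\Omega_{QS}=(\{p_i\}_{i=2}^n,\{a_i\}_{i=2}^{n-1},\{q_i\}_{i=1}^{n-1},\{d_i\}_{i=1}^n,\{g_i\}_{i=1}^{n-1},\{b_i\}_{i=2}^{n-1},\{h_i\}_{i=2}^n)$ with $A(i,i)=d_i$, $A(i,j)=p_ia_{i-1}a_{i-2}\cdots a_{j+1}q_j$ for $i>j$, and $A(i,j)=g_ib_{i+1}b_{i+2}\cdots b_{j-1}h_j$ for $i<j$ (empty products equal 1); $A$ is $\{1;1\}$-quasiseparable if and only if it has such a representation. Sparse representation of $B$: $B=\sum_{k=1}^M\omega_k^BS_k$, where the $S_k\in\mathbb{R}^{n\times m}$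 are fixed constant matrices (typically with entries 0 and 1) and $\Omega_B=(\omega^B_1,\dots,\omega^B_M)$ are independent real parameters, independent of those of $A$. $|Z|$ denotes the entrywise absolute value, $\|Z\|_{\max}=\max_{i,j}|z_{ij}|$, inequalities are entrywise. Define (with $\eta>0$) $$\mathscr{K}^{QS}_{|\Omega_B|}:=\lim_{\eta\to0}\sup\left\{\frac1\eta\frac{\|\delta X\|_{\max}}{\|X\|_{\max}}: A(\Omega_{QS}+\delta\Omega_{QS})(X+\delta X)=B(\Omega_B+\delta\Omega_B),\ |\delta\Omega_{QS}|\le\eta|\Omega_{QS}|,\ |\delta\Omega_B|\le\eta|\Omega_B|\right\}.$$ Writing $A=A_L+A_D+A_U$ with $A_L$ strictly lower triangular, $A_D$ diagonal, $A_U$ strictly upper triangular, the effective condition number is $$\mathscr{K}_{\rm eff}(A(\Omega_{QS}),B(\Omega_B)):=\frac{1}{\|X\|_{\max}}\Big\|\sum_{k=1}^M|A^{-1}S_k||\omega_k^B|+|A^{-1}||A_D||X|+|A^{-1}||A_LX|+|A^{-1}A_L||X|+|A^{-1}||A_UX|+|A^{-1}A_U||X|\Big\|_{\max}.$$ *)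

theory Defs
  imports "HOL-Analysis.Analysis"
begin

(* Rows and columns of an n x n matrix are indexed by a finite linearly ordered type 'n,
   n = CARD('n), which plays the role of {1..n}.
   In every constructor name the letter is that of the parameter family. *)
datatype 'n qs_index = P_ix 'n | A_ix 'n | Q_ix 'n | D_ix 'n | G_ix 'n | B_ix 'n | H_ix 'n

(* "\<exists>j. j < i" says that i is not the first index, "\<exists>j. i < j" that it is not the last one.
   A representation is a function on 'n qs_index of which only the values on this set matter;
   lemma card_qs_params confirms the parameter count 7n - 8. *)
definition qs_params :: "'n::{finite,linorder} qs_index set" where
  "qs_params =
     P_ix ` {i. \<exists>j. j < i} \<union> A_ix ` {i. (\<exists>j. j < i) \<and> (\<exists>j. i < j)} \<union> Q_ix ` {i. \<exists>j. i < j} \<union>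
     D_ix ` UNIV \<union>
     G_ix ` {i. \<exists>j. i < j} \<union> B_ix ` {i. (\<exists>j. j < i) \<and> (\<exists>j. i < j)} \<union> H_ix ` {i. \<exists>j. j < i}"

definition qs_matrix :: "('n::{finite,linorder} qs_index \<Rightarrow> real)
    \<Rightarrow> real^'n::{finite,linorder}^'n::{finite,linorder}" where
  "qs_matrix \<Omega> = (\<chi> i j.
     if i = j then \<Omega> (D_ix i)
     else if j < i then \<Omega> (P_ix i) * (\<Prod>k\<in>{j<..<i}. \<Omega> (A_ix k)) * \<Omega> (Q_ix j)
     else \<Omega> (G_ix i) * (\<Prod>k\<in>{i<..<j}. \<Omega> (B_ix k)) * \<Omega> (H_ix j))"

lemma in_qs_params_simps:
  "P_ix i \<in> qs_params \<longleftrightarrow> (\<exists>j. j < i)" "Q_ix i \<in> qs_params \<longleftrightarrow> (\<exists>j. i < j)"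
  "G_ix i \<in> qs_params \<longleftrightarrow> (\<exists>j. i < j)" "H_ix i \<in> qs_params \<longleftrightarrow> (\<exists>j. j < i)"
  "A_ix i \<in> qs_params \<longleftrightarrow> (\<exists>j. j < i) \<and> (\<exists>j. i < j)"
  "B_ix i \<in> qs_params \<longleftrightarrow> (\<exists>j. j < i) \<and> (\<exists>j. i < j)"
  "D_ix i \<in> qs_params"
  by (auto simp: qs_params_def image_iff)

lemma qs_matrix_cong:
  assumes "\<And>k. k \<in> qs_params \<Longrightarrow> \<Omega> k = \<Omega>' k"
  shows "qs_matrix \<Omega> = qs_matrix \<Omega>'"
proof -
  have "qs_matrix \<Omega> $ i $ j = qs_matrix \<Omega>' $ i $ j" for i j
    unfolding qs_matrix_def
    by (cases i j rule: linorder_cases)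
       (auto simp: in_qs_params_simps
         intro!: arg_cong2[where f = "(*)"] prod.cong assms)
  then show ?thesis
    by (simp add: vec_eq_iff)
qed

lemma card_qs_params:
  assumes "CARD('n :: {finite,linorder}) \<ge> 2"
  shows "card (qs_params :: 'n qs_index set) = 7 * CARD('n) - 8"
proof -
  let ?a = "Min (UNIV :: 'n set)" and ?b = "Max (UNIV :: 'n set)"
  have ab: "?a \<noteq> ?b"
  proof
    assume eq: "?a = ?b"
    have "i = ?a" for i :: 'n
      using Min_le[of "UNIV :: 'n set" i] Max_ge[of "UNIV :: 'n set" i] eq by (metis UNIV_I antisym finite)
    then have "UNIV = {?a}"
      by blast
    then have "CARD('n) = 1"
      by (metis is_singletonI is_singleton_altdef)
    then show False
      using assms by simp
  qed
  have a: "?a \<le> i" and b: "i \<le> ?b" for i :: 'n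
    by simp_all
  have lo: "{i::'n. \<exists>j. j < i} = UNIV - {?a}"
  proof (intro set_eqI iffI)
    fix i :: 'n assume "i \<in> {i. \<exists>j. j < i}"
    then show "i \<in> UNIV - {?a}" using a leD by blast
  next
    fix i :: 'n assume "i \<in> UNIV - {?a}"
    then have "?a < i" using a[of i] by (metis DiffD2 insertI1 order_le_imp_less_or_eq)
    then show "i \<in> {i. \<exists>j. j < i}" by blast
  qed
  have hi: "{i::'n. \<exists>j. i < j} = UNIV - {?b}"
  proof (intro set_eqI iffI)
    fix i :: 'n assume "i \<in> {i. \<exists>j. i < j}"
    then show "i \<in> UNIV - {?b}" using b leD by blast
  next
    fix i :: 'n assume "i \<in> UNIV - {?b}"
    then have "i < ?b" using b[of i] by (metis DiffD2 insertI1 order_le_imp_less_or_eq)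
    then show "i \<in> {i. \<exists>j. i < j}" by blast
  qed
  have mid: "{i::'n. (\<exists>j. j < i) \<and> (\<exists>j. i < j)} = UNIV - {?a, ?b}"
    using lo hi by blast
  have c: "card (UNIV - {?a}) = CARD('n) - 1" "card (UNIV - {?b}) = CARD('n) - 1"
    "card (UNIV - {?a, ?b}) = CARD('n) - 2"
    using ab by (simp_all add: card_Diff_subset)
  show ?thesis
    unfolding qs_params_def lo hi mid
    using assms
    by (subst card_Un_disjoint, simp, simp, blast)+
       (simp add: c card_image inj_on_def)
qed

(* S k is used for k = 1..M only. *)
definition sparse_matrix :: "nat \<Rightarrow> (nat \<Rightarrow> real^'m^'n) \<Rightarrow> (nat \<Rightarrow> real) \<Rightarrow> real^'m^'n" where
  "sparse_matrix M S \<omega> = (\<Sum>k=1..M. \<omega> k *\<^sub>R S k)"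

definition max_norm :: "real^'m^'n \<Rightarrow> real" where
  "max_norm Z = Max {\<bar>Z $ i $ j\<bar> | i j. True}"

(* The supremum and the limit are taken in the extended reals: for large \<eta> the perturbed
   coefficient matrix can be singular, and then the set may be unbounded. *)
definition qs_error_sup ::
  "('n::{finite,linorder} qs_index \<Rightarrow> real) \<Rightarrow> nat \<Rightarrow> (nat \<Rightarrow> real^'m^'n::{finite,linorder}) \<Rightarrow> (nat \<Rightarrow> real)
    \<Rightarrow> real^'m^'n::{finite,linorder} \<Rightarrow> real \<Rightarrow> ereal" where
  "qs_error_sup \<Omega> M S \<omega> X \<eta> =
     Sup {ereal (1 / \<eta> * (max_norm \<delta>X / max_norm X)) | \<delta>X \<delta>\<Omega> \<delta>\<omega>.
       qs_matrix (\<lambda>k. \<Omega> k + \<delta>\<Omega> k) ** (X + \<delta>X) = sparse_matrix M S (\<lambda>k. \<omega> k + \<delta>\<omega> k) \<and>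
       (\<forall>k\<in>qs_params. \<bar>\<delta>\<Omega> k\<bar> \<le> \<eta> * \<bar>\<Omega> k\<bar>) \<and>
       (\<forall>k\<in>{1..M}. \<bar>\<delta>\<omega> k\<bar> \<le> \<eta> * \<bar>\<omega> k\<bar>)}"

definition cond_qs ::
  "('n::{finite,linorder} qs_index \<Rightarrow> real) \<Rightarrow> nat \<Rightarrow> (nat \<Rightarrow> real^'m^'n::{finite,linorder}) \<Rightarrow> (nat \<Rightarrow> real)
    \<Rightarrow> real^'m^'n::{finite,linorder} \<Rightarrow> ereal" where
  "cond_qs \<Omega> M S \<omega> X = Lim (at_right 0) (qs_error_sup \<Omega> M S \<omega> X)"

definition lower_part ::
  "real^'n::{finite,linorder}^'n::{finite,linorder} \<Rightarrow> real^'n::{finite,linorder}^'n::{finite,linorder}" where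
  "lower_part A = (\<chi> i j. if j < i then A $ i $ j else 0)"

definition diag_part ::
  "real^'n::{finite,linorder}^'n::{finite,linorder} \<Rightarrow> real^'n::{finite,linorder}^'n::{finite,linorder}" where
  "diag_part A = (\<chi> i j. if i = j then A $ i $ j else 0)"

definition upper_part ::
  "real^'n::{finite,linorder}^'n::{finite,linorder} \<Rightarrow> real^'n::{finite,linorder}^'n::{finite,linorder}" where
  "upper_part A = (\<chi> i j. if i < j then A $ i $ j else 0)"

(* On matrices the library's absolute value is the entrywise one. *)
definition cond_eff ::
  "real^'n::{finite,linorder}^'n::{finite,linorder} \<Rightarrow> nat \<Rightarrow> (nat \<Rightarrow> real^'m^'n::{finite,linorder}) \<Rightarrow> (nat \<Rightarrow> real)
    \<Rightarrow> real^'m^'n::{finite,linorder} \<Rightarrow> real" where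
  "cond_eff A M S \<omega> X =
     1 / max_norm X * max_norm
       ((\<Sum>k=1..M. \<bar>\<omega> k\<bar> *\<^sub>R \<bar>matrix_inv A ** S k\<bar>)
        + \<bar>matrix_inv A\<bar> ** \<bar>diag_part A\<bar> ** \<bar>X\<bar>
        + \<bar>matrix_inv A\<bar> ** \<bar>lower_part A ** X\<bar>
        + \<bar>matrix_inv A ** lower_part A\<bar> ** \<bar>X\<bar>
        + \<bar>matrix_inv A\<bar> ** \<bar>upper_part A ** X\<bar>
        + \<bar>matrix_inv A ** upper_part A\<bar> ** \<bar>X\<bar>)"

end

theory Submission
  imports Defs
begin

text \<open>
  Every entry of a quasiseparable matrix is a monomial in the parameters, in which each parameter
  occurs at most once.  A relative perturbation \<open>\<Omega> k * (1 + x k)\<close> therefore changes the matrix to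
  first order by \<open>\<Sum>k. x k *\<^sub>R param_part A k\<close>, where \<open>param_part A k\<close> keeps those entries of
  \<open>A\<close> that contain the parameter \<open>k\<close>, and the solution of \<open>A ** X = B\<close> changes by
  \<open>linear_response\<close>, a linear form in \<open>x\<close> and in the relative perturbation \<open>y\<close> of the parameters
  of \<open>B\<close>.  Its largest modulus in a given entry, over all \<open>\<bar>x k\<bar>, \<bar>y k\<bar> \<le> \<eta>\<close>, is \<open>\<eta>\<close> times
  the sum of the moduli of its coefficients, the corresponding entry of \<open>sensitivity\<close>.  The error of
  the linearisation is \<open>O(\<eta>\<^sup>2)\<close> uniformly in the perturbation (\<open>solution_first_order\<close>), so that
  the supremum in the definition of the condition number is squeezed between two explicit functions
  of \<open>\<eta>\<close> with the common limit \<open>max_norm sensitivity / max_norm X\<close> (\<open>qs_error_sup_tendsto\<close>).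

  It remains to compare \<open>sensitivity\<close> with the matrix in the effective condition number.  Write
  \<open>A = L + D + U\<close> and \<open>W\<close> for the inverse of \<open>A\<close>.  The parameter \<open>p i\<close> controls the \<open>i\<close>-th row of
  \<open>L\<close> and \<open>q j\<close> its \<open>j\<close>-th column; summed over all indices they contribute exactly
  \<open>\<bar>W\<bar> ** \<bar>L ** X\<bar>\<close> and \<open>\<bar>W ** L\<bar> ** \<bar>X\<bar>\<close>.  In the same way \<open>g\<close> and \<open>h\<close> give the terms with \<open>U\<close>
  and \<open>d\<close> gives the diagonal term.  Hence \<open>sensitivity\<close> is the effective matrix plus the
  contributions of the \<open>a k\<close> and \<open>b k\<close> (\<open>sensitivity_split\<close>), which proves the lower bound.  The
  parameter \<open>a k\<close> controls the block of \<open>L\<close> below row \<open>k\<close> and left of column \<open>k\<close>.  As \<open>L\<close> is strictly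
  lower triangular, this block is the difference of the rows of \<open>L\<close> below \<open>k\<close> and of its
  columns from \<open>k\<close> on (\<open>param_part_interior\<close>), so one \<open>a k\<close> contributes at most
  \<open>\<bar>W\<bar> ** \<bar>L ** X\<bar> + \<bar>W ** L\<bar> ** \<bar>X\<bar>\<close>.  The same holds for \<open>b k\<close> and \<open>U\<close>.  There are \<open>n - 2\<close> interior
  indices \<open>k\<close>, whence the factor \<open>1 + (n - 2) = n - 1\<close> of the upper bound.
\<close>

section \<open>The entrywise maximum norm\<close>

lemma max_norm_set_finite: "finite {\<bar>Z $ i $ j\<bar> | i j. True}" for Z :: "real^'m^'n"
proof -
  have "{\<bar>Z $ i $ j\<bar> | i j. True} = (\<lambda>(i, j). \<bar>Z $ i $ j\<bar>) ` UNIV"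
    by auto
  then show ?thesis
    by simp
qed

lemma abs_entry_le_max_norm: "\<bar>Z $ i $ j\<bar> \<le> max_norm Z"
  unfolding max_norm_def by (rule Max_ge[OF max_norm_set_finite]) blast

lemma max_norm_attained: obtains i j where "max_norm Z = \<bar>Z $ i $ j\<bar>"
proof -
  have "max_norm Z \<in> {\<bar>Z $ i $ j\<bar> | i j. True}"
    unfolding max_norm_def by (rule Max_in[OF max_norm_set_finite]) blast
  then show ?thesis
    using that by blast
qed

lemma max_norm_leI: "(\<And>i j. \<bar>Z $ i $ j\<bar> \<le> c) \<Longrightarrow> max_norm Z \<le> c"
  by (metis max_norm_attained)

lemma max_norm_nonneg: "0 \<le> max_norm Z"
  by (metis abs_ge_zero max_norm_attained)

lemma max_norm_mono: "(\<And>i j. \<bar>Y $ i $ j\<bar> \<le> \<bar>Z $ i $ j\<bar>) \<Longrightarrow> max_norm Y \<le> max_norm Z"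
  by (meson abs_entry_le_max_norm max_norm_leI order_trans)

lemma max_norm_scaleR: "max_norm (c *\<^sub>R Z) = \<bar>c\<bar> * max_norm Z"
proof (rule antisym)
  show "max_norm (c *\<^sub>R Z) \<le> \<bar>c\<bar> * max_norm Z"
    by (rule max_norm_leI) (simp add: abs_mult abs_entry_le_max_norm mult_left_mono)
  obtain i j where "max_norm Z = \<bar>Z $ i $ j\<bar>"
    by (rule max_norm_attained)
  then show "\<bar>c\<bar> * max_norm Z \<le> max_norm (c *\<^sub>R Z)"
    using abs_entry_le_max_norm[of "c *\<^sub>R Z" i j] by (simp add: abs_mult)
qed

lemma max_norm_mult_le:
  fixes Y :: "real^'k^'n" and Z :: "real^'m^'k"
  shows "max_norm (Y ** Z) \<le> real CARD('k) * max_norm Y * max_norm Z"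
proof (rule max_norm_leI)
  fix i j
  have "\<bar>(Y ** Z) $ i $ j\<bar> \<le> (\<Sum>k\<in>UNIV. \<bar>Y $ i $ k\<bar> * \<bar>Z $ k $ j\<bar>)"
    by (simp add: matrix_matrix_mult_def order_trans[OF sum_abs] abs_mult)
  also have "\<dots> \<le> (\<Sum>k\<in>(UNIV :: 'k set). max_norm Y * max_norm Z)"
    by (intro sum_mono mult_mono abs_entry_le_max_norm max_norm_nonneg) simp
  finally show "\<bar>(Y ** Z) $ i $ j\<bar> \<le> real CARD('k) * max_norm Y * max_norm Z"
    by simp
qed

lemma max_norm_mult3_le:
  fixes W D :: "real^'n^'n" and Z :: "real^'m^'n"
  shows "max_norm (W ** D ** Z) \<le> (real CARD('n))\<^sup>2 * max_norm W * max_norm D * max_norm Z"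
proof -
  have "max_norm (W ** D ** Z) \<le> real CARD('n) * (real CARD('n) * max_norm W * max_norm D) * max_norm Z"
    by (intro order_trans[OF max_norm_mult_le] mult_left_mono mult_right_mono max_norm_mult_le
        max_norm_nonneg) simp
  then show ?thesis
    by (simp add: power2_eq_square mult_ac)
qed

lemma max_norm_minus_minus_le: "max_norm (- Y - Z) \<le> max_norm Y + max_norm Z"
proof (rule max_norm_leI)
  fix i j
  show "\<bar>(- Y - Z) $ i $ j\<bar> \<le> max_norm Y + max_norm Z"
    using abs_entry_le_max_norm[of Y i j] abs_entry_le_max_norm[of Z i j] by simp
qed

section \<open>Matrix algebra\<close>

lemma matrix_inv_left_mult: "invertible A \<Longrightarrow> matrix_inv A ** A = mat 1"
  unfolding invertible_def matrix_inv_def by (rule someI2_ex) auto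

lemma matrix_add_rdistrib: "(Y + Z) ** W = Y ** W + Z ** W"
  for Y Z :: "real^'k^'n"
  by (simp add: vec_eq_iff matrix_matrix_mult_def distrib_right sum.distrib)

lemma matrix_mult_linear_combination:
  fixes F :: "'i \<Rightarrow> real^'k^'l"
  shows "W ** (\<Sum>k\<in>K. c k *\<^sub>R F k) ** Z = (\<Sum>k\<in>K. c k *\<^sub>R (W ** F k ** Z))"
proof -
  have "linear (\<lambda>F. W ** F ** Z)"
    by (rule linearI)
       (simp_all add: matrix_add_ldistrib matrix_add_rdistrib matrix_scalar_ac
          flip: scalar_matrix_assoc)
  then show ?thesis
    by (simp add: linear_sum[where f = "\<lambda>F. W ** F ** Z"] linear_scale[where f = "\<lambda>F. W ** F ** Z"])
qed

text \<open>
  If \<open>A + D\<close> annihilates a column \<open>V\<close>, then \<open>V = - (matrix_inv A ** D ** V)\<close>, which is shorter than \<open>V\<close>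
  unless \<open>V = 0\<close>.
\<close>
lemma invertible_perturbation:
  fixes A D :: "real^'n^'n"
  assumes "invertible A"
    and small: "(real CARD('n))\<^sup>2 * max_norm (matrix_inv A) * max_norm D < 1"
  shows "invertible (A + D)"
proof -
  let ?W = "matrix_inv A"
  have "v = 0" if v: "(A + D) *v v = 0" for v
  proof -
    define V :: "real^1^'n" where "V = (\<chi> i j. v $ i)"
    have "(A + D) ** V = 0"
      using v by (simp add: vec_eq_iff V_def matrix_matrix_mult_def matrix_vector_mult_def)
    then have "?W ** A ** V + ?W ** D ** V = 0"
      by (metis matrix_add_ldistrib matrix_add_rdistrib matrix_mul_assoc
          matrix_mul_rid matrix_mul_assoc add.right_neutral add_cancel_right_right)
    then have "V = - (?W ** D ** V)"
      using assms(1) by (simp add: matrix_inv_left_mult eq_neg_iff_add_eq_0)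
    then have "max_norm V = max_norm (?W ** D ** V)"
      by (metis max_norm_scaleR abs_minus_cancel abs_one mult_1 scaleR_minus1_left)
    also have "\<dots> \<le> ((real CARD('n))\<^sup>2 * max_norm ?W * max_norm D) * max_norm V"
      by (rule max_norm_mult3_le)
    finally have "max_norm V \<le> ((real CARD('n))\<^sup>2 * max_norm ?W * max_norm D) * max_norm V" .
    then have "max_norm V = 0"
      using small max_norm_nonneg[of V]
      by (metis less_eq_real_def mult_le_cancel_right1 not_less)
    then show "v = 0"
      using abs_entry_le_max_norm[of V _ 1] by (simp add: V_def vec_eq_iff)
  qed
  then have "\<exists>P. P ** (A + D) = mat 1"
    using matrix_left_invertible_ker by blast
  then show ?thesis
    using matrix_left_right_inverse invertible_def by blast
qed

definition keep_rows :: "'n set \<Rightarrow> real^'m^'n \<Rightarrow> real^'m^'n" where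
  "keep_rows I Z = (\<chi> i j. if i \<in> I then Z $ i $ j else 0)"

definition keep_cols :: "'m set \<Rightarrow> real^'m^'n \<Rightarrow> real^'m^'n" where
  "keep_cols J Z = (\<chi> i j. if j \<in> J then Z $ i $ j else 0)"

lemma mult_keep_rows_entry:
  "(W ** keep_rows I Z ** Y) $ r $ s = (\<Sum>i\<in>I. W $ r $ i * (Z ** Y) $ i $ s)"
proof -
  have "(keep_rows I Z ** Y) $ i $ s = (if i \<in> I then (Z ** Y) $ i $ s else 0)" for i
    by (simp add: matrix_matrix_mult_def keep_rows_def)
  then have "(W ** (keep_rows I Z ** Y)) $ r $ s
      = (\<Sum>i\<in>UNIV. if i \<in> I then W $ r $ i * (Z ** Y) $ i $ s else 0)"
    by (subst matrix_matrix_mult_def) (auto intro!: sum.cong)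
  then show ?thesis
    by (simp add: matrix_mul_assoc sum.If_cases)
qed

lemma mult_keep_cols_entry:
  "(W ** keep_cols J Z ** Y) $ r $ s = (\<Sum>j\<in>J. (W ** Z) $ r $ j * Y $ j $ s)"
proof -
  have "(W ** keep_cols J Z) $ r $ j = (if j \<in> J then (W ** Z) $ r $ j else 0)" for j
    by (simp add: matrix_matrix_mult_def keep_cols_def)
  then have "(W ** keep_cols J Z ** Y) $ r $ s
      = (\<Sum>j\<in>UNIV. if j \<in> J then (W ** Z) $ r $ j * Y $ j $ s else 0)"
    by (subst matrix_matrix_mult_def) (auto intro!: sum.cong)
  then show ?thesis
    by (simp add: sum.If_cases)
qed

lemma abs_matrix_entry: "\<bar>Z\<bar> $ i $ j = \<bar>Z $ i $ j\<bar>" for Z :: "real^'m^'n"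
  by (simp add: abs_vec_def)

lemma abs_mult_abs_entry:
  "(\<bar>Y\<bar> ** \<bar>Z\<bar>) $ r $ s = (\<Sum>i\<in>UNIV. \<bar>Y $ r $ i * Z $ i $ s\<bar>)"
  for Y :: "real^'k^'n" and Z :: "real^'m^'k"
  by (simp add: matrix_matrix_mult_def abs_matrix_entry abs_mult)

section \<open>Relative perturbations of a monomial\<close>

text \<open>
  The factor \<open>2 ^ card F - 1\<close>, in place of \<open>2 ^ card F\<close>, is what the induction reproduces: a new factor
  doubles the bound and adds \<open>\<eta>\<close>.
\<close>
lemma prod_one_plus_bound:
  fixes x :: "'i \<Rightarrow> real"
  assumes "finite F" and "0 \<le> \<eta>" "\<eta> \<le> 1" and "\<And>k. k \<in> F \<Longrightarrow> \<bar>x k\<bar> \<le> \<eta>"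
  shows "\<bar>(\<Prod>k\<in>F. 1 + x k) - 1\<bar> \<le> (2 ^ card F - 1) * \<eta>"
  using assms(1,4)
proof (induction F rule: finite_induct)
  case empty
  then show ?case by simp
next
  case (insert k F)
  let ?P = "\<Prod>k\<in>F. 1 + x k"
  have "\<bar>(\<Prod>k\<in>insert k F. 1 + x k) - 1\<bar> = \<bar>(?P - 1) * (1 + x k) + x k\<bar>"
    using insert.hyps by (simp add: algebra_simps)
  also have "\<dots> \<le> \<bar>?P - 1\<bar> * \<bar>1 + x k\<bar> + \<bar>x k\<bar>"
    by (metis abs_mult abs_triangle_ineq)
  also have "\<dots> \<le> \<bar>?P - 1\<bar> * 2 + \<bar>x k\<bar>"
    using insert.prems[of k] assms(3) by (intro add_right_mono mult_left_mono) auto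
  also have "\<dots> \<le> ((2 ^ card F - 1) * \<eta>) * 2 + \<eta>"
    using insert.IH insert.prems[of k] insert.prems assms(2,3)
    by (intro add_mono mult_mono) auto
  finally show ?case
    using insert.hyps by (simp add: algebra_simps)
qed

text \<open>
  A new factor \<open>1 + x k\<close> adds \<open>x k * (\<Prod> - 1)\<close> to the remainder, which the previous bound makes
  quadratic in \<open>\<eta>\<close>.
\<close>
lemma prod_one_plus_first_order:
  fixes x :: "'i \<Rightarrow> real"
  assumes "finite F" and "0 \<le> \<eta>" "\<eta> \<le> 1" and "\<And>k. k \<in> F \<Longrightarrow> \<bar>x k\<bar> \<le> \<eta>"
  shows "\<bar>(\<Prod>k\<in>F. 1 + x k) - 1 - (\<Sum>k\<in>F. x k)\<bar> \<le> 4 ^ card F * \<eta>\<^sup>2"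
  using assms(1,4)
proof (induction F rule: finite_induct)
  case empty
  then show ?case by simp
next
  case (insert k F)
  let ?P = "\<Prod>k\<in>F. 1 + x k" and ?s = "\<Sum>k\<in>F. x k"
  have "(2::real) ^ card F \<le> 4 ^ card F"
    by (rule power_mono) auto
  then have pow: "(2::real) ^ card F - 1 \<le> 4 ^ card F"
    by linarith
  have "\<bar>(\<Prod>k\<in>insert k F. 1 + x k) - 1 - (\<Sum>k\<in>insert k F. x k)\<bar>
      = \<bar>(?P - 1 - ?s) + x k * (?P - 1)\<bar>"
    using insert.hyps by (simp add: algebra_simps)
  also have "\<dots> \<le> \<bar>?P - 1 - ?s\<bar> + \<bar>x k\<bar> * \<bar>?P - 1\<bar>"
    by (metis abs_mult abs_triangle_ineq)
  also have "\<dots> \<le> 4 ^ card F * \<eta>\<^sup>2 + \<eta> * (4 ^ card F * \<eta>)"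
  proof (intro add_mono mult_mono)
    show "\<bar>?P - 1\<bar> \<le> 4 ^ card F * \<eta>"
      using prod_one_plus_bound[OF insert.hyps(1) assms(2,3)] insert.prems
        mult_right_mono[OF pow assms(2)] by force
  qed (use insert assms(2) in auto)
  also have "\<dots> \<le> 4 ^ card (insert k F) * \<eta>\<^sup>2"
    using insert.hyps assms(2) by (simp add: power2_eq_square)
  finally show ?case .
qed

section \<open>Quasiseparable matrices under relative perturbation of the parameters\<close>

text \<open>
  No parameter occurs twice in an entry, so a set suffices to describe the monomial.
\<close>
definition qs_factors :: "'n::{finite,linorder} \<Rightarrow> 'n \<Rightarrow> 'n qs_index set" where
  "qs_factors i j =
     (if i = j then {D_ix i}
      else if j < i then {P_ix i, Q_ix j} \<union> A_ix ` {j<..<i}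
      else {G_ix i, H_ix j} \<union> B_ix ` {i<..<j})"

lemma finite_qs_params: "finite qs_params"
  by (simp add: qs_params_def)

lemma qs_factors_subset: "qs_factors i j \<subseteq> qs_params"
  by (cases i j rule: linorder_cases) (auto simp: qs_factors_def in_qs_params_simps)

lemma finite_qs_factors: "finite (qs_factors i j)"
  by (rule finite_subset[OF qs_factors_subset finite_qs_params])

lemma qs_matrix_entry: "qs_matrix \<Omega> $ i $ j = (\<Prod>k\<in>qs_factors i j. \<Omega> k)"
proof (cases i j rule: linorder_cases)
  case less
  have "qs_factors i j = insert (G_ix i) (insert (H_ix j) (B_ix ` {i<..<j}))"
    using less by (auto simp: qs_factors_def)
  then have "(\<Prod>k\<in>qs_factors i j. \<Omega> k) = \<Omega> (G_ix i) * (\<Omega> (H_ix j) * (\<Prod>k\<in>B_ix ` {i<..<j}. \<Omega> k))"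
    by (simp add: image_iff)
  then show ?thesis
    using less by (simp add: qs_matrix_def prod.reindex inj_on_def less_imp_not_less less_imp_not_eq)
next
  case greater
  have "qs_factors i j = insert (P_ix i) (insert (Q_ix j) (A_ix ` {j<..<i}))"
    using greater by (auto simp: qs_factors_def)
  then have "(\<Prod>k\<in>qs_factors i j. \<Omega> k) = \<Omega> (P_ix i) * (\<Omega> (Q_ix j) * (\<Prod>k\<in>A_ix ` {j<..<i}. \<Omega> k))"
    by (simp add: image_iff)
  then show ?thesis
    using greater by (simp add: qs_matrix_def prod.reindex inj_on_def less_imp_not_less less_imp_not_eq2)
qed (simp add: qs_factors_def qs_matrix_def)

text \<open>
  Since the entries are multilinear in the parameters, for \<open>A = qs_matrix \<Omega>\<close> this is
  \<open>\<Omega> k\<close> times the partial derivative of \<open>A\<close> with respect to \<open>\<Omega> k\<close>.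
\<close>
definition param_part ::
  "real^'n::{finite,linorder}^'n::{finite,linorder} \<Rightarrow> 'n qs_index
    \<Rightarrow> real^'n::{finite,linorder}^'n::{finite,linorder}" where
  "param_part A k = (\<chi> i j. if k \<in> qs_factors i j then A $ i $ j else 0)"

text \<open>
  An entry \<open>A $ i $ j\<close> is multiplied by \<open>\<Prod>k\<in>qs_factors i j. 1 + x k\<close>, so both bounds come from those
  on this product; as it has at most \<open>card qs_params\<close> factors, they are uniform in \<open>i\<close> and \<open>j\<close>.
\<close>
lemma qs_matrix_relative_first_order:
  fixes \<Omega> x :: "'n::{finite,linorder} qs_index \<Rightarrow> real"
  assumes "0 \<le> \<eta>" "\<eta> \<le> 1" and x: "\<And>k. k \<in> qs_params \<Longrightarrow> \<bar>x k\<bar> \<le> \<eta>"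
  defines "A \<equiv> qs_matrix \<Omega>"
  defines "D \<equiv> qs_matrix (\<lambda>k. \<Omega> k * (1 + x k)) - A"
  shows "max_norm D \<le> 4 ^ card (qs_params :: 'n qs_index set) * max_norm A * \<eta>"
    and "max_norm (D - (\<Sum>k\<in>qs_params. x k *\<^sub>R param_part A k))
           \<le> 4 ^ card (qs_params :: 'n qs_index set) * max_norm A * \<eta>\<^sup>2"
proof -
  let ?p = "card (qs_params :: 'n qs_index set)"
  have D: "D $ i $ j = A $ i $ j * ((\<Prod>k\<in>qs_factors i j. 1 + x k) - 1)" for i j
    by (simp add: D_def A_def qs_matrix_entry prod.distrib right_diff_distrib)
  have x': "\<And>k. k \<in> qs_factors i j \<Longrightarrow> \<bar>x k\<bar> \<le> \<eta>" for i j
    using x qs_factors_subset by blast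
  have pow_le: "(4::real) ^ card (qs_factors i j) \<le> 4 ^ ?p" for i j :: 'n
    by (rule power_increasing[OF card_mono[OF finite_qs_params qs_factors_subset]]) simp
  show "max_norm D \<le> 4 ^ ?p * max_norm A * \<eta>"
  proof (rule max_norm_leI)
    fix i j :: 'n
    have "(2::real) ^ card (qs_factors i j) \<le> 4 ^ card (qs_factors i j)"
      by (rule power_mono) auto
    then have "(2::real) ^ card (qs_factors i j) - 1 \<le> 4 ^ ?p"
      using pow_le[of i j] by linarith
    moreover have "\<bar>(\<Prod>k\<in>qs_factors i j. 1 + x k) - 1\<bar> \<le> (2 ^ card (qs_factors i j) - 1) * \<eta>"
      by (rule prod_one_plus_bound[OF finite_qs_factors assms(1,2) x'])
    ultimately have "\<bar>(\<Prod>k\<in>qs_factors i j. 1 + x k) - 1\<bar> \<le> 4 ^ ?p * \<eta>"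
      using assms(1) by (meson mult_right_mono order_trans)
    then show "\<bar>D $ i $ j\<bar> \<le> 4 ^ ?p * max_norm A * \<eta>"
      using mult_mono[OF abs_entry_le_max_norm[of A i j],
          of "\<bar>(\<Prod>k\<in>qs_factors i j. 1 + x k) - 1\<bar>" "4 ^ ?p * \<eta>"]
      by (simp add: D abs_mult max_norm_nonneg mult_ac)
  qed
  show "max_norm (D - (\<Sum>k\<in>qs_params. x k *\<^sub>R param_part A k)) \<le> 4 ^ ?p * max_norm A * \<eta>\<^sup>2"
  proof (rule max_norm_leI)
    fix i j :: 'n
    let ?r = "(\<Prod>k\<in>qs_factors i j. 1 + x k) - 1 - (\<Sum>k\<in>qs_factors i j. x k)"
    have "(\<Sum>k\<in>qs_params. x k *\<^sub>R param_part A k) $ i $ j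
        = (\<Sum>k\<in>qs_params. if k \<in> qs_factors i j then A $ i $ j * x k else 0)"
      by (auto simp: param_part_def intro!: sum.cong)
    also have "\<dots> = A $ i $ j * (\<Sum>k\<in>qs_factors i j. x k)"
      using sum.inter_restrict[OF finite_qs_params, of "\<lambda>k. A $ i $ j * x k" "qs_factors i j"]
        qs_factors_subset[of i j]
      by (simp add: Int_absorb1 sum_distrib_left)
    finally have eq: "(D - (\<Sum>k\<in>qs_params. x k *\<^sub>R param_part A k)) $ i $ j = A $ i $ j * ?r"
      by (simp add: D algebra_simps)
    have "\<bar>?r\<bar> \<le> 4 ^ card (qs_factors i j) * \<eta>\<^sup>2"
      by (rule prod_one_plus_first_order[OF finite_qs_factors assms(1,2) x'])
    also have "\<dots> \<le> 4 ^ ?p * \<eta>\<^sup>2"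
      by (rule mult_right_mono[OF pow_le]) simp
    finally have "\<bar>?r\<bar> \<le> 4 ^ ?p * \<eta>\<^sup>2" .
    then show "\<bar>(D - (\<Sum>k\<in>qs_params. x k *\<^sub>R param_part A k)) $ i $ j\<bar>
        \<le> 4 ^ ?p * max_norm A * \<eta>\<^sup>2"
      using mult_mono[OF abs_entry_le_max_norm[of A i j], of "\<bar>?r\<bar>" "4 ^ ?p * \<eta>\<^sup>2"]
      unfolding eq by (simp add: abs_mult max_norm_nonneg mult_ac)
  qed
qed

section \<open>The solution to first order\<close>

definition linear_response ::
  "('n::{finite,linorder} qs_index \<Rightarrow> real) \<Rightarrow> nat \<Rightarrow> (nat \<Rightarrow> real^'m^'n::{finite,linorder}) \<Rightarrow> (nat \<Rightarrow> real)
    \<Rightarrow> real^'m^'n::{finite,linorder} \<Rightarrow> ('n qs_index \<Rightarrow> real) \<Rightarrow> (nat \<Rightarrow> real)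
    \<Rightarrow> real^'m^'n::{finite,linorder}" where
  "linear_response \<Omega> M S \<omega> X x y = (let A = qs_matrix \<Omega>; W = matrix_inv A in
     (\<Sum>k=1..M. (y k * \<omega> k) *\<^sub>R (W ** S k)) - (\<Sum>k\<in>qs_params. x k *\<^sub>R (W ** param_part A k ** X)))"

text \<open>
  Entry by entry, this is the norm of the linear form \<open>linear_response\<close> in \<open>x\<close> and \<open>y\<close> when
  perturbations are measured by their largest component.
\<close>
definition sensitivity ::
  "('n::{finite,linorder} qs_index \<Rightarrow> real) \<Rightarrow> nat \<Rightarrow> (nat \<Rightarrow> real^'m^'n::{finite,linorder}) \<Rightarrow> (nat \<Rightarrow> real)
    \<Rightarrow> real^'m^'n::{finite,linorder} \<Rightarrow> real^'m^'n::{finite,linorder}" where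
  "sensitivity \<Omega> M S \<omega> X = (let A = qs_matrix \<Omega>; W = matrix_inv A in
     (\<Sum>k=1..M. \<bar>\<omega> k\<bar> *\<^sub>R \<bar>W ** S k\<bar>) + (\<Sum>k\<in>qs_params. \<bar>W ** param_part A k ** X\<bar>))"

lemma sensitivity_entry:
  "sensitivity \<Omega> M S \<omega> X $ r $ s =
     (\<Sum>k=1..M. \<bar>\<omega> k * (matrix_inv (qs_matrix \<Omega>) ** S k) $ r $ s\<bar>) +
     (\<Sum>k\<in>qs_params. \<bar>(matrix_inv (qs_matrix \<Omega>) ** param_part (qs_matrix \<Omega>) k ** X) $ r $ s\<bar>)"
  by (simp add: sensitivity_def Let_def abs_matrix_entry abs_mult)

lemma sensitivity_nonneg: "0 \<le> sensitivity \<Omega> M S \<omega> X $ r $ s"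
  by (simp add: sensitivity_entry sum_nonneg)

lemma linear_response_entry:
  "linear_response \<Omega> M S \<omega> X x y $ r $ s =
     (\<Sum>k=1..M. y k * (\<omega> k * (matrix_inv (qs_matrix \<Omega>) ** S k) $ r $ s)) -
     (\<Sum>k\<in>qs_params. x k * (matrix_inv (qs_matrix \<Omega>) ** param_part (qs_matrix \<Omega>) k ** X) $ r $ s)"
  by (simp add: linear_response_def Let_def mult.assoc)

lemma linear_response_le:
  fixes x :: "'n::{finite,linorder} qs_index \<Rightarrow> real"
  assumes "\<And>k. k \<in> qs_params \<Longrightarrow> \<bar>x k\<bar> \<le> \<eta>" and "\<And>k. k \<in> {1..M} \<Longrightarrow> \<bar>y k\<bar> \<le> \<eta>"
  shows "\<bar>linear_response \<Omega> M S \<omega> X x y $ r $ s\<bar> \<le> \<eta> * sensitivity \<Omega> M S \<omega> X $ r $ s"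
  unfolding linear_response_entry sensitivity_entry distrib_left sum_distrib_left
  by (intro order_trans[OF abs_triangle_ineq4] add_mono order_trans[OF sum_abs] sum_mono)
     (auto simp: abs_mult assms mult_right_mono)

text \<open>
  For one fixed entry all signs can be chosen to avoid cancellation, so the bound
  \<open>linear_response_le\<close> is attained there.
\<close>
lemma linear_response_extremal:
  fixes \<Omega> :: "'n::{finite,linorder} qs_index \<Rightarrow> real"
  assumes "0 \<le> \<eta>"
  obtains x y where "\<And>k. \<bar>x k\<bar> \<le> \<eta>" "\<And>k. \<bar>y k\<bar> \<le> \<eta>"
    "linear_response \<Omega> M S \<omega> X x y $ r $ s = \<eta> * sensitivity \<Omega> M S \<omega> X $ r $ s"
proof
  let ?W = "matrix_inv (qs_matrix \<Omega>)"
  let ?x = "\<lambda>k. - \<eta> * sgn ((?W ** param_part (qs_matrix \<Omega>) k ** X) $ r $ s)"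
  let ?y = "\<lambda>k. \<eta> * sgn (\<omega> k * (?W ** S k) $ r $ s)"
  show "\<bar>?x k\<bar> \<le> \<eta>" "\<bar>?y l\<bar> \<le> \<eta>" for k l
    using assms by (simp_all add: abs_mult abs_sgn_eq)
  have sgn_mult: "sgn a * a = \<bar>a\<bar>" for a :: real
    by (simp add: abs_sgn mult.commute)
  show "linear_response \<Omega> M S \<omega> X ?x ?y $ r $ s = \<eta> * sensitivity \<Omega> M S \<omega> X $ r $ s"
    unfolding linear_response_entry sensitivity_entry
    by (simp only: mult.assoc sgn_mult minus_mult_left[symmetric] sum_negf distrib_left
        sum_distrib_left diff_minus_eq_add)
qed

text \<open>
  The unknown \<open>Y\<close> on the right occurs only together with \<open>D\<close>, so that term is of second order.
\<close>
lemma perturbed_solution_identity: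
  fixes A D :: "real^'n^'n" and X Y B E :: "real^'m^'n"
  assumes "invertible A" and "A ** X = B" and "(A + D) ** (X + Y) = B + E"
  shows "Y = matrix_inv A ** E - matrix_inv A ** D ** X - matrix_inv A ** D ** Y"
proof -
  let ?W = "matrix_inv A"
  have "A ** Y + D ** X + D ** Y = E"
    using assms(2,3) by (simp add: matrix_add_ldistrib matrix_add_rdistrib algebra_simps)
  then have "?W ** (A ** Y + D ** X + D ** Y) = ?W ** E"
    by simp
  then have "Y + ?W ** D ** X + ?W ** D ** Y = ?W ** E"
    using assms(1) by (simp add: matrix_add_ldistrib matrix_mul_assoc matrix_inv_left_mult)
  then show ?thesis
    by (simp add: algebra_simps)
qed

text \<open>
  This constant times \<open>\<eta>\<close> bounds the norm of the map \<open>\<lambda>Z. matrix_inv A ** D ** Z\<close> for every change \<open>D\<close>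
  of \<open>A\<close> that is caused by relative perturbations of the parameters of size at most \<open>\<eta> \<le> 1\<close>.
\<close>
definition remainder_const :: "('n::{finite,linorder} qs_index \<Rightarrow> real) \<Rightarrow> real" where
  "remainder_const \<Omega> = (real CARD('n))\<^sup>2 * max_norm (matrix_inv (qs_matrix \<Omega>)) *
     (4 ^ card (qs_params :: 'n qs_index set) * max_norm (qs_matrix \<Omega>))"

lemma remainder_const_nonneg: "0 \<le> remainder_const \<Omega>"
  by (simp add: remainder_const_def max_norm_nonneg)

text \<open>
  By \<open>perturbed_solution_identity\<close> the remainder consists of the quadratic part of the change of \<open>A\<close>
  applied to \<open>X\<close> and of the whole change applied to \<open>Y\<close>.  The second part is bounded by a
  small multiple of \<open>max_norm Y\<close> itself, to be absorbed on the left in \<open>qs_error_sup_le\<close>.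
\<close>
lemma solution_first_order:
  fixes \<Omega> x :: "'n::{finite,linorder} qs_index \<Rightarrow> real" and X Y :: "real^'m^'n::{finite,linorder}"
  assumes inv: "invertible (qs_matrix \<Omega>)" and sol: "qs_matrix \<Omega> ** X = sparse_matrix M S \<omega>"
    and \<eta>: "0 \<le> \<eta>" "\<eta> \<le> 1" and x: "\<And>k. k \<in> qs_params \<Longrightarrow> \<bar>x k\<bar> \<le> \<eta>"
    and pert: "qs_matrix (\<lambda>k. \<Omega> k * (1 + x k)) ** (X + Y) = sparse_matrix M S (\<lambda>k. \<omega> k * (1 + y k))"
  shows "max_norm (Y - linear_response \<Omega> M S \<omega> X x y)
           \<le> remainder_const \<Omega> * \<eta> * (\<eta> * max_norm X + max_norm Y)"
proof -
  define A where "A = qs_matrix \<Omega>"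
  define W where "W = matrix_inv A"
  define D where "D = qs_matrix (\<lambda>k. \<Omega> k * (1 + x k)) - A"
  define D1 where "D1 = (\<Sum>k\<in>qs_params. x k *\<^sub>R param_part A k)"
  define E where "E = (\<Sum>k=1..M. (y k * \<omega> k) *\<^sub>R S k)"
  let ?p = "card (qs_params :: 'n qs_index set)" and ?n = "real CARD('n)"
  have "sparse_matrix M S (\<lambda>k. \<omega> k * (1 + y k)) = sparse_matrix M S \<omega> + E"
    by (simp add: sparse_matrix_def E_def algebra_simps sum.distrib)
  then have "(A + D) ** (X + Y) = sparse_matrix M S \<omega> + E"
    using pert by (simp add: D_def)
  then have Y: "Y = W ** E - W ** D ** X - W ** D ** Y"
    unfolding W_def using inv sol by (intro perturbed_solution_identity) (auto simp: A_def)
  have "linear_response \<Omega> M S \<omega> X x y = W ** E - W ** D1 ** X"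
    using matrix_mult_linear_combination[of W "\<lambda>k. y k * \<omega> k" S "{1..M}" "mat 1"]
    by (simp add: linear_response_def Let_def E_def D1_def matrix_mult_linear_combination W_def A_def)
  moreover have "W ** D ** X = W ** (D - D1) ** X + W ** D1 ** X"
    by (simp flip: matrix_add_ldistrib matrix_add_rdistrib)
  ultimately have "Y - linear_response \<Omega> M S \<omega> X x y = - (W ** (D - D1) ** X) - W ** D ** Y"
    by (subst Y) simp
  then have "max_norm (Y - linear_response \<Omega> M S \<omega> X x y)
      \<le> max_norm (W ** (D - D1) ** X) + max_norm (W ** D ** Y)"
    by (simp add: max_norm_minus_minus_le)
  also have "\<dots> \<le> ?n\<^sup>2 * max_norm W * max_norm (D - D1) * max_norm X
      + ?n\<^sup>2 * max_norm W * max_norm D * max_norm Y"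
    by (intro add_mono max_norm_mult3_le)
  also have "\<dots> \<le> ?n\<^sup>2 * max_norm W * (4 ^ ?p * max_norm A * \<eta>\<^sup>2) * max_norm X
      + ?n\<^sup>2 * max_norm W * (4 ^ ?p * max_norm A * \<eta>) * max_norm Y"
    unfolding D_def D1_def A_def
    by (intro add_mono mult_right_mono mult_left_mono qs_matrix_relative_first_order \<eta> x
        max_norm_nonneg mult_nonneg_nonneg zero_le_power2)
  also have "\<dots> = remainder_const \<Omega> * \<eta> * (\<eta> * max_norm X + max_norm Y)"
    by (simp add: remainder_const_def W_def A_def algebra_simps power2_eq_square)
  finally show ?thesis .
qed

lemma invertible_relative_perturbation:
  fixes \<Omega> x :: "'n::{finite,linorder} qs_index \<Rightarrow> real"
  assumes "invertible (qs_matrix \<Omega>)" and \<eta>: "0 \<le> \<eta>" "\<eta> \<le> 1"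
    and small: "remainder_const \<Omega> * \<eta> < 1" and x: "\<And>k. k \<in> qs_params \<Longrightarrow> \<bar>x k\<bar> \<le> \<eta>"
  shows "invertible (qs_matrix (\<lambda>k. \<Omega> k * (1 + x k)))"
proof -
  let ?A = "qs_matrix \<Omega>"
  let ?D = "qs_matrix (\<lambda>k. \<Omega> k * (1 + x k)) - ?A"
  have "(real CARD('n))\<^sup>2 * max_norm (matrix_inv ?A) * max_norm ?D
      \<le> (real CARD('n))\<^sup>2 * max_norm (matrix_inv ?A) *
          (4 ^ card (qs_params :: 'n qs_index set) * max_norm ?A * \<eta>)"
    by (intro mult_left_mono qs_matrix_relative_first_order \<eta> x mult_nonneg_nonneg
        max_norm_nonneg zero_le_power2)
  also have "\<dots> < 1"
    using small by (simp add: remainder_const_def mult_ac)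
  finally have "invertible (?A + ?D)"
    by (rule invertible_perturbation[OF assms(1)])
  then show ?thesis
    by simp
qed

section \<open>The condition number as a limit\<close>

text \<open>
  A parameter that is zero is not perturbed at all, so every admissible absolute perturbation has
  the relative form \<open>\<Omega> k * (1 + x k)\<close> with \<open>\<bar>x k\<bar> \<le> \<eta>\<close>.  Evaluating the first-order expansion at the
  largest entry of \<open>Y\<close> gives \<open>max_norm Y \<le> \<eta> N + c \<eta> (\<eta> max_norm X + max_norm Y)\<close>, where \<open>N\<close> is the norm of
  the sensitivity and \<open>c\<close> the remainder constant; solve for \<open>max_norm Y\<close>.
\<close>
lemma qs_error_sup_le:
  fixes \<Omega> :: "'n::{finite,linorder} qs_index \<Rightarrow> real" and X :: "real^'m^'n::{finite,linorder}"
  assumes inv: "invertible (qs_matrix \<Omega>)" and sol: "qs_matrix \<Omega> ** X = sparse_matrix M S \<omega>"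
    and X: "0 < max_norm X"
    and \<eta>: "0 < \<eta>" "\<eta> \<le> 1" and small: "remainder_const \<Omega> * \<eta> < 1"
  shows "qs_error_sup \<Omega> M S \<omega> X \<eta> \<le>
    ereal ((max_norm (sensitivity \<Omega> M S \<omega> X) + remainder_const \<Omega> * \<eta> * max_norm X) /
           ((1 - remainder_const \<Omega> * \<eta>) * max_norm X))"
  unfolding qs_error_sup_def
proof (rule Sup_least, clarify)
  fix Y :: "real^'m^'n::{finite,linorder}" and \<delta>\<Omega> :: "'n qs_index \<Rightarrow> real" and \<delta>\<omega> :: "nat \<Rightarrow> real"
  assume pert: "qs_matrix (\<lambda>k. \<Omega> k + \<delta>\<Omega> k) ** (X + Y) = sparse_matrix M S (\<lambda>k. \<omega> k + \<delta>\<omega> k)"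
    and \<delta>\<Omega>: "\<forall>k\<in>qs_params. \<bar>\<delta>\<Omega> k\<bar> \<le> \<eta> * \<bar>\<Omega> k\<bar>" and \<delta>\<omega>: "\<forall>k\<in>{1..M}. \<bar>\<delta>\<omega> k\<bar> \<le> \<eta> * \<bar>\<omega> k\<bar>"
  let ?c = "remainder_const \<Omega>" and ?N = "max_norm (sensitivity \<Omega> M S \<omega> X)"
  have relative: "u + d = u * (1 + d / u) \<and> \<bar>d / u\<bar> \<le> \<eta>" if "\<bar>d\<bar> \<le> \<eta> * \<bar>u\<bar>" for d u :: real
    using that \<eta> by (cases "u = 0") (auto simp: field_simps abs_divide)
  define x where "x k = \<delta>\<Omega> k / \<Omega> k" for k
  define y where "y k = \<delta>\<omega> k / \<omega> k" for k
  have x: "\<Omega> k + \<delta>\<Omega> k = \<Omega> k * (1 + x k)" "\<bar>x k\<bar> \<le> \<eta>" if "k \<in> qs_params" for k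
    unfolding x_def using relative \<delta>\<Omega> that by blast+
  have y: "\<omega> k + \<delta>\<omega> k = \<omega> k * (1 + y k)" "\<bar>y k\<bar> \<le> \<eta>" if "k \<in> {1..M}" for k
    unfolding y_def using relative \<delta>\<omega> that by blast+
  have "sparse_matrix M S (\<lambda>k. \<omega> k + \<delta>\<omega> k) = sparse_matrix M S (\<lambda>k. \<omega> k * (1 + y k))"
    unfolding sparse_matrix_def using y(1) by (intro sum.cong) simp_all
  moreover have "qs_matrix (\<lambda>k. \<Omega> k + \<delta>\<Omega> k) = qs_matrix (\<lambda>k. \<Omega> k * (1 + x k))"
    by (rule qs_matrix_cong) (rule x(1))
  ultimately have "max_norm (Y - linear_response \<Omega> M S \<omega> X x y)
      \<le> ?c * \<eta> * (\<eta> * max_norm X + max_norm Y)"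
    using pert \<eta> x(2) by (intro solution_first_order[OF inv sol]) auto
  moreover obtain r s where rs: "max_norm Y = \<bar>Y $ r $ s\<bar>"
    by (rule max_norm_attained)
  moreover have "\<bar>linear_response \<Omega> M S \<omega> X x y $ r $ s\<bar> \<le> \<eta> * ?N"
  proof -
    have "\<bar>linear_response \<Omega> M S \<omega> X x y $ r $ s\<bar> \<le> \<eta> * sensitivity \<Omega> M S \<omega> X $ r $ s"
      by (rule linear_response_le) (use x(2) y(2) in auto)
    also have "\<dots> \<le> \<eta> * ?N"
      using abs_entry_le_max_norm[of "sensitivity \<Omega> M S \<omega> X" r s] \<eta>
      by (intro mult_left_mono) auto
    finally show ?thesis .
  qed
  ultimately have "max_norm Y \<le> \<eta> * ?N + ?c * \<eta> * (\<eta> * max_norm X + max_norm Y)"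
    using abs_entry_le_max_norm[of "Y - linear_response \<Omega> M S \<omega> X x y" r s] by simp
  then have "(1 - ?c * \<eta>) * max_norm Y \<le> \<eta> * (?N + ?c * \<eta> * max_norm X)"
    by (simp add: algebra_simps)
  moreover have "1 / \<eta> * (m / z) \<le> u / (v * z)" if "v * m \<le> \<eta> * u" "0 < v" "0 < z" for u v m z
    using that \<eta> by (simp add: field_simps)
  ultimately have "1 / \<eta> * (max_norm Y / max_norm X)
      \<le> (?N + ?c * \<eta> * max_norm X) / ((1 - ?c * \<eta>) * max_norm X)"
    using small X by simp
  then show "ereal (1 / \<eta> * (max_norm Y / max_norm X))
      \<le> ereal ((?N + ?c * \<eta> * max_norm X) / ((1 - ?c * \<eta>) * max_norm X))"
    by simp
qed

text \<open>
  The perturbation that is extremal for the largest entry of the sensitivity is admissible, because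
  the perturbed matrix is still invertible and so a perturbed solution exists.
\<close>
lemma qs_error_sup_ge:
  fixes \<Omega> :: "'n::{finite,linorder} qs_index \<Rightarrow> real" and X :: "real^'m^'n::{finite,linorder}"
  assumes inv: "invertible (qs_matrix \<Omega>)" and sol: "qs_matrix \<Omega> ** X = sparse_matrix M S \<omega>"
    and X: "0 < max_norm X"
    and \<eta>: "0 < \<eta>" "\<eta> \<le> 1" and small: "remainder_const \<Omega> * \<eta> < 1"
  shows "ereal ((max_norm (sensitivity \<Omega> M S \<omega> X) - remainder_const \<Omega> * \<eta> * max_norm X) /
           ((1 + remainder_const \<Omega> * \<eta>) * max_norm X)) \<le> qs_error_sup \<Omega> M S \<omega> X \<eta>"
proof -
  let ?c = "remainder_const \<Omega>" and ?N = "max_norm (sensitivity \<Omega> M S \<omega> X)"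
  obtain r s where "?N = \<bar>sensitivity \<Omega> M S \<omega> X $ r $ s\<bar>"
    by (rule max_norm_attained)
  then have N: "?N = sensitivity \<Omega> M S \<omega> X $ r $ s"
    by (simp add: sensitivity_nonneg)
  obtain x y where x: "\<And>k. \<bar>x k\<bar> \<le> \<eta>" and y: "\<And>k. \<bar>y k\<bar> \<le> \<eta>"
    and resp: "linear_response \<Omega> M S \<omega> X x y $ r $ s = \<eta> * ?N"
    using linear_response_extremal[of \<eta> \<Omega> M S \<omega> X r s] \<eta> N by (metis less_imp_le)
  have "invertible (qs_matrix (\<lambda>k. \<Omega> k * (1 + x k)))"
    by (rule invertible_relative_perturbation[OF inv _ \<eta>(2) small]) (use \<eta> x in auto)
  then obtain P where P: "qs_matrix (\<lambda>k. \<Omega> k * (1 + x k)) ** P = mat 1"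
    by (auto simp: invertible_def)
  define Y where "Y = P ** sparse_matrix M S (\<lambda>k. \<omega> k * (1 + y k)) - X"
  have pert: "qs_matrix (\<lambda>k. \<Omega> k * (1 + x k)) ** (X + Y) = sparse_matrix M S (\<lambda>k. \<omega> k * (1 + y k))"
    by (simp add: Y_def matrix_mul_assoc P)
  have "max_norm (Y - linear_response \<Omega> M S \<omega> X x y) \<le> ?c * \<eta> * (\<eta> * max_norm X + max_norm Y)"
    using \<eta> x by (intro solution_first_order[OF inv sol _ _ _ pert]) auto
  then have "\<eta> * ?N \<le> max_norm Y + ?c * \<eta> * (\<eta> * max_norm X + max_norm Y)"
    using abs_entry_le_max_norm[of "Y - linear_response \<Omega> M S \<omega> X x y" r s]
      abs_entry_le_max_norm[of Y r s] resp by simp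
  then have "\<eta> * (?N - ?c * \<eta> * max_norm X) \<le> (1 + ?c * \<eta>) * max_norm Y"
    by (simp add: algebra_simps)
  moreover have "0 < 1 + ?c * \<eta>"
    using remainder_const_nonneg[of \<Omega>] \<eta> by (simp add: add_pos_nonneg)
  moreover have "u / (v * z) \<le> 1 / \<eta> * (m / z)" if "\<eta> * u \<le> v * m" "0 < v" "0 < z" for u v m z
    using that \<eta> by (simp add: field_simps)
  ultimately have "(?N - ?c * \<eta> * max_norm X) / ((1 + ?c * \<eta>) * max_norm X)
      \<le> 1 / \<eta> * (max_norm Y / max_norm X)"
    using X by blast
  then have "ereal ((?N - ?c * \<eta> * max_norm X) / ((1 + ?c * \<eta>) * max_norm X))
      \<le> ereal (1 / \<eta> * (max_norm Y / max_norm X))"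
    by simp
  also have "\<dots> \<le> qs_error_sup \<Omega> M S \<omega> X \<eta>"
    unfolding qs_error_sup_def
  proof (rule Sup_upper, rule CollectI, intro exI conjI ballI)
    show "qs_matrix (\<lambda>k. \<Omega> k + \<Omega> k * x k) ** (X + Y) = sparse_matrix M S (\<lambda>k. \<omega> k + \<omega> k * y k)"
      using pert by (simp add: algebra_simps)
  qed (simp_all add: abs_mult mult.commute[of \<eta>] mult_left_mono x y)
  finally show ?thesis .
qed

theorem qs_error_sup_tendsto:
  fixes \<Omega> :: "'n::{finite,linorder} qs_index \<Rightarrow> real" and X :: "real^'m^'n::{finite,linorder}"
  assumes "invertible (qs_matrix \<Omega>)" and "qs_matrix \<Omega> ** X = sparse_matrix M S \<omega>"
    and X: "0 < max_norm X"
  shows "(qs_error_sup \<Omega> M S \<omega> X \<longlongrightarrow>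
    ereal (max_norm (sensitivity \<Omega> M S \<omega> X) / max_norm X)) (at_right 0)"
proof -
  let ?c = "remainder_const \<Omega>" and ?N = "max_norm (sensitivity \<Omega> M S \<omega> X)"
  have ident: "((\<lambda>\<eta>::real. \<eta>) \<longlongrightarrow> 0) (at_right 0)"
    by (rule tendsto_ident_at)
  have c0: "((\<lambda>\<eta>. ?c * \<eta>) \<longlongrightarrow> 0) (at_right 0)"
    by (rule tendsto_mult_right_zero[OF ident])
  then have "\<forall>\<^sub>F \<eta> in at_right 0. ?c * \<eta> < 1"
    by (rule order_tendstoD) simp
  moreover have "\<forall>\<^sub>F \<eta> in at_right 0. (\<eta>::real) < 1"
    by (rule order_tendstoD[OF ident]) simp
  ultimately have ev: "\<forall>\<^sub>F \<eta> in at_right 0. 0 < \<eta> \<and> \<eta> \<le> 1 \<and> ?c * \<eta> < 1"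
    using eventually_at_right_less[of "0::real"] by eventually_elim simp
  show ?thesis
  proof (rule tendsto_sandwich)
    show "\<forall>\<^sub>F \<eta> in at_right 0.
        ereal ((?N - ?c * \<eta> * max_norm X) / ((1 + ?c * \<eta>) * max_norm X)) \<le> qs_error_sup \<Omega> M S \<omega> X \<eta>"
      using ev by eventually_elim (simp add: qs_error_sup_ge assms)
    show "\<forall>\<^sub>F \<eta> in at_right 0. qs_error_sup \<Omega> M S \<omega> X \<eta>
        \<le> ereal ((?N + ?c * \<eta> * max_norm X) / ((1 - ?c * \<eta>) * max_norm X))"
      using ev by eventually_elim (simp add: qs_error_sup_le assms)
    have "((\<lambda>\<eta>. (?N - ?c * \<eta> * max_norm X) / ((1 + ?c * \<eta>) * max_norm X))
        \<longlongrightarrow> (?N - 0 * max_norm X) / ((1 + 0) * max_norm X)) (at_right 0)"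
      using X by (intro tendsto_intros c0) simp
    then show "((\<lambda>\<eta>. ereal ((?N - ?c * \<eta> * max_norm X) / ((1 + ?c * \<eta>) * max_norm X)))
        \<longlongrightarrow> ereal (?N / max_norm X)) (at_right 0)"
      by simp
    have "((\<lambda>\<eta>. (?N + ?c * \<eta> * max_norm X) / ((1 - ?c * \<eta>) * max_norm X))
        \<longlongrightarrow> (?N + 0 * max_norm X) / ((1 - 0) * max_norm X)) (at_right 0)"
      using X by (intro tendsto_intros c0) simp
    then show "((\<lambda>\<eta>. ereal ((?N + ?c * \<eta> * max_norm X) / ((1 - ?c * \<eta>) * max_norm X)))
        \<longlongrightarrow> ereal (?N / max_norm X)) (at_right 0)"
      by simp
  qed
qed

section \<open>Sensitivity and the effective condition number\<close>

lemma sum_qs_params: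
  "sum f (qs_params :: 'n::{finite,linorder} qs_index set) =
    (\<Sum>i\<in>UNIV. f (D_ix i)) +
    (\<Sum>i | \<exists>j. j < i. f (P_ix i)) + (\<Sum>i | \<exists>j. i < j. f (Q_ix i)) +
    (\<Sum>i | \<exists>j. i < j. f (G_ix i)) + (\<Sum>i | \<exists>j. j < i. f (H_ix i)) +
    (\<Sum>i | (\<exists>j. j < i) \<and> (\<exists>j. i < j). f (A_ix i)) +
    (\<Sum>i | (\<exists>j. j < i) \<and> (\<exists>j. i < j). f (B_ix i))"
  for f :: "'n::{finite,linorder} qs_index \<Rightarrow> real"
  unfolding qs_params_def
  by (subst sum.union_disjoint, simp, simp, blast)+
     (simp add: sum.reindex inj_on_def)

lemma param_part_endpoint:
  "param_part A (D_ix i) = keep_rows {i} (diag_part A)"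
  "param_part A (P_ix i) = keep_rows {i} (lower_part A)"
  "param_part A (Q_ix i) = keep_cols {i} (lower_part A)"
  "param_part A (G_ix i) = keep_rows {i} (upper_part A)"
  "param_part A (H_ix i) = keep_cols {i} (upper_part A)"
  by (auto simp: vec_eq_iff param_part_def qs_factors_def keep_rows_def keep_cols_def
      diag_part_def lower_part_def upper_part_def)

text \<open>
  The block that \<open>a k\<close> controls consists of the entries \<open>(i, j)\<close> with \<open>j < k < i\<close>.  Among the rows
  \<open>i > k\<close> of the lower part one has to remove the columns \<open>j \<ge> k\<close>; all nonzero entries of these
  columns lie in rows \<open>i > j \<ge> k\<close>, so the restriction to the rows \<open>i > k\<close> can be dropped for them.  The argument
  for \<open>b k\<close> is symmetric.
\<close>
lemma param_part_interior:
  "param_part A (A_ix k) = keep_rows {k<..} (lower_part A) - keep_cols {k..} (lower_part A)"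
  "param_part A (B_ix k) = keep_rows {..<k} (upper_part A) - keep_cols {..k} (upper_part A)"
  by (auto simp: vec_eq_iff param_part_def qs_factors_def keep_rows_def keep_cols_def
      lower_part_def upper_part_def)

text \<open>
  The families \<open>p\<close>, \<open>q\<close>, \<open>g\<close>, \<open>h\<close> each miss one end of the index range, where the corresponding row or
  column of the triangular part vanishes; this lets their sums run over all indices.
\<close>
lemma lower_part_first_row: "\<not> (\<exists>j. j < i) \<Longrightarrow> keep_rows {i} (lower_part A) = 0"
  by (auto simp: vec_eq_iff keep_rows_def lower_part_def)

lemma lower_part_last_col: "\<not> (\<exists>j. i < j) \<Longrightarrow> keep_cols {i} (lower_part A) = 0"
  by (auto simp: vec_eq_iff keep_cols_def lower_part_def)

lemma upper_part_last_row: "\<not> (\<exists>j. i < j) \<Longrightarrow> keep_rows {i} (upper_part A) = 0"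
  by (auto simp: vec_eq_iff keep_rows_def upper_part_def)

lemma upper_part_first_col: "\<not> (\<exists>j. j < i) \<Longrightarrow> keep_cols {i} (upper_part A) = 0"
  by (auto simp: vec_eq_iff keep_cols_def upper_part_def)

lemma card_interior:
  assumes "CARD('n::{finite,linorder}) \<ge> 2"
  shows "real (card {i::'n. (\<exists>j. j < i) \<and> (\<exists>j. i < j)}) \<le> real CARD('n) - 2"
proof -
  let ?a = "Min (UNIV :: 'n set)" and ?b = "Max (UNIV :: 'n set)"
  have "?a \<noteq> ?b"
  proof
    assume eq: "?a = ?b"
    have "i = ?a" for i :: 'n
      using Min_le[of UNIV i] Max_ge[of UNIV i] eq by (metis UNIV_I antisym finite)
    then have "(UNIV :: 'n set) = {?a}"
      by blast
    then have "CARD('n) = 1"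
      by (metis is_singletonI is_singleton_altdef)
    then show False
      using assms by simp
  qed
  then have "card (UNIV - {?a, ?b}) = CARD('n) - 2"
    by (simp add: card_Diff_subset)
  moreover have "{i::'n. (\<exists>j. j < i) \<and> (\<exists>j. i < j)} \<subseteq> UNIV - {?a, ?b}"
    using Min_le[of "UNIV :: 'n set"] Max_ge[of "UNIV :: 'n set"] by (auto simp: not_less[symmetric])
  ultimately have "card {i::'n. (\<exists>j. j < i) \<and> (\<exists>j. i < j)} \<le> CARD('n) - 2"
    by (metis card_mono finite)
  then show ?thesis
    using assms by linarith
qed

lemma keep_rows_minus_keep_cols_bound:
  fixes W :: "real^'n^'n" and L :: "real^'n^'n" and X :: "real^'m^'n"
  shows "\<bar>(W ** (keep_rows I L - keep_cols J L) ** X) $ r $ s\<bar>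
    \<le> (\<bar>W\<bar> ** \<bar>L ** X\<bar>) $ r $ s + (\<bar>W ** L\<bar> ** \<bar>X\<bar>) $ r $ s"
proof -
  have "W ** (keep_rows I L - keep_cols J L) ** X
      = W ** keep_rows I L ** X - W ** keep_cols J L ** X"
    by (simp add: eq_diff_eq flip: matrix_add_ldistrib matrix_add_rdistrib)
  then have "\<bar>(W ** (keep_rows I L - keep_cols J L) ** X) $ r $ s\<bar>
      = \<bar>(\<Sum>i\<in>I. W $ r $ i * (L ** X) $ i $ s) - (\<Sum>j\<in>J. (W ** L) $ r $ j * X $ j $ s)\<bar>"
    by (simp add: mult_keep_rows_entry mult_keep_cols_entry)
  also have "\<dots> \<le> (\<Sum>i\<in>I. \<bar>W $ r $ i * (L ** X) $ i $ s\<bar>) + (\<Sum>j\<in>J. \<bar>(W ** L) $ r $ j * X $ j $ s\<bar>)"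
    by (intro order_trans[OF abs_triangle_ineq4] add_mono sum_abs)
  also have "\<dots> \<le> (\<bar>W\<bar> ** \<bar>L ** X\<bar>) $ r $ s + (\<bar>W ** L\<bar> ** \<bar>X\<bar>) $ r $ s"
    unfolding abs_mult_abs_entry by (intro add_mono sum_mono2) auto
  finally show ?thesis .
qed

definition effective_sensitivity ::
  "('n::{finite,linorder} qs_index \<Rightarrow> real) \<Rightarrow> nat \<Rightarrow> (nat \<Rightarrow> real^'m^'n::{finite,linorder}) \<Rightarrow> (nat \<Rightarrow> real)
    \<Rightarrow> real^'m^'n::{finite,linorder} \<Rightarrow> real^'m^'n::{finite,linorder}" where
  "effective_sensitivity \<Omega> M S \<omega> X = (let A = qs_matrix \<Omega>; W = matrix_inv A in
     (\<Sum>k=1..M. \<bar>\<omega> k\<bar> *\<^sub>R \<bar>W ** S k\<bar>) + \<bar>W\<bar> ** \<bar>diag_part A\<bar> ** \<bar>X\<bar>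
     + \<bar>W\<bar> ** \<bar>lower_part A ** X\<bar> + \<bar>W ** lower_part A\<bar> ** \<bar>X\<bar>
     + \<bar>W\<bar> ** \<bar>upper_part A ** X\<bar> + \<bar>W ** upper_part A\<bar> ** \<bar>X\<bar>)"

lemma cond_eff_effective_sensitivity:
  "cond_eff (qs_matrix \<Omega>) M S \<omega> X = max_norm (effective_sensitivity \<Omega> M S \<omega> X) / max_norm X"
  by (simp add: cond_eff_def effective_sensitivity_def Let_def)

lemma abs_diag_part_mult_entry:
  "(\<bar>diag_part A\<bar> ** \<bar>X\<bar>) $ i $ s = \<bar>(diag_part A ** X) $ i $ s\<bar>"
proof -
  have "(diag_part A ** X) $ i $ s = A $ i $ i * X $ i $ s"
    by (simp add: matrix_matrix_mult_def diag_part_def if_distrib[of "\<lambda>u. u * _"] sum.delta cong: if_cong)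
  moreover have "(\<bar>diag_part A\<bar> ** \<bar>X\<bar>) $ i $ s = \<bar>A $ i $ i\<bar> * \<bar>X $ i $ s\<bar>"
    by (simp add: matrix_matrix_mult_def abs_matrix_entry diag_part_def
        if_distrib[of "\<lambda>u. \<bar>u\<bar> * _"] sum.delta cong: if_cong)
  ultimately show ?thesis
    by (simp add: abs_mult)
qed

text \<open>
  Each parameter that controls a single row or column yields one product in the sums
  which make up a product of entrywise absolute values; only the interior parameters remain.
\<close>
lemma sensitivity_split:
  fixes \<Omega> :: "'n::{finite,linorder} qs_index \<Rightarrow> real" and X :: "real^'m^'n::{finite,linorder}"
  defines "W \<equiv> matrix_inv (qs_matrix \<Omega>)"
  shows "sensitivity \<Omega> M S \<omega> X $ r $ s = effective_sensitivity \<Omega> M S \<omega> X $ r $ s +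
    (\<Sum>i | (\<exists>j. j < i) \<and> (\<exists>j. i < j). \<bar>(W ** param_part (qs_matrix \<Omega>) (A_ix i) ** X) $ r $ s\<bar>) +
    (\<Sum>i | (\<exists>j. j < i) \<and> (\<exists>j. i < j). \<bar>(W ** param_part (qs_matrix \<Omega>) (B_ix i) ** X) $ r $ s\<bar>)"
proof -
  let ?A = "qs_matrix \<Omega>"
  let ?L = "lower_part ?A" and ?U = "upper_part ?A"
  let ?f = "\<lambda>k. \<bar>(W ** param_part ?A k ** X) $ r $ s\<bar>"
  have zero: "\<bar>(W ** (0 :: real^'n::{finite,linorder}^'n::{finite,linorder}) ** X) $ r $ s\<bar> = 0"
    by (simp add: matrix_matrix_mult_def)
  have D: "(\<Sum>i\<in>UNIV. ?f (D_ix i)) = (\<bar>W\<bar> ** \<bar>diag_part ?A\<bar> ** \<bar>X\<bar>) $ r $ s"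
  proof -
    have "(\<bar>W\<bar> ** (\<bar>diag_part ?A\<bar> ** \<bar>X\<bar>)) $ r $ s
        = (\<Sum>i\<in>UNIV. \<bar>W $ r $ i\<bar> * \<bar>(diag_part ?A ** X) $ i $ s\<bar>)"
      by (subst matrix_matrix_mult_def) (simp add: abs_diag_part_mult_entry abs_matrix_entry)
    then show ?thesis
      by (simp add: param_part_endpoint mult_keep_rows_entry abs_mult matrix_mul_assoc)
  qed
  have P: "(\<Sum>i | \<exists>j. j < i. ?f (P_ix i)) = (\<bar>W\<bar> ** \<bar>?L ** X\<bar>) $ r $ s"
  proof -
    have "(\<Sum>i | \<exists>j. j < i. ?f (P_ix i)) = (\<Sum>i\<in>UNIV. ?f (P_ix i))"
      by (rule sum.mono_neutral_left) (auto simp: param_part_endpoint lower_part_first_row zero)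
    then show ?thesis
      by (simp add: param_part_endpoint mult_keep_rows_entry abs_mult_abs_entry)
  qed
  have Q: "(\<Sum>i | \<exists>j. i < j. ?f (Q_ix i)) = (\<bar>W ** ?L\<bar> ** \<bar>X\<bar>) $ r $ s"
  proof -
    have "(\<Sum>i | \<exists>j. i < j. ?f (Q_ix i)) = (\<Sum>i\<in>UNIV. ?f (Q_ix i))"
      by (rule sum.mono_neutral_left) (auto simp: param_part_endpoint lower_part_last_col zero)
    then show ?thesis
      by (simp add: param_part_endpoint mult_keep_cols_entry abs_mult_abs_entry)
  qed
  have G: "(\<Sum>i | \<exists>j. i < j. ?f (G_ix i)) = (\<bar>W\<bar> ** \<bar>?U ** X\<bar>) $ r $ s"
  proof -
    have "(\<Sum>i | \<exists>j. i < j. ?f (G_ix i)) = (\<Sum>i\<in>UNIV. ?f (G_ix i))"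
      by (rule sum.mono_neutral_left) (auto simp: param_part_endpoint upper_part_last_row zero)
    then show ?thesis
      by (simp add: param_part_endpoint mult_keep_rows_entry abs_mult_abs_entry)
  qed
  have H: "(\<Sum>i | \<exists>j. j < i. ?f (H_ix i)) = (\<bar>W ** ?U\<bar> ** \<bar>X\<bar>) $ r $ s"
  proof -
    have "(\<Sum>i | \<exists>j. j < i. ?f (H_ix i)) = (\<Sum>i\<in>UNIV. ?f (H_ix i))"
      by (rule sum.mono_neutral_left) (auto simp: param_part_endpoint upper_part_first_col zero)
    then show ?thesis
      by (simp add: param_part_endpoint mult_keep_cols_entry abs_mult_abs_entry)
  qed
  have "effective_sensitivity \<Omega> M S \<omega> X $ r $ s = (\<Sum>k=1..M. \<bar>\<omega> k * (W ** S k) $ r $ s\<bar>) +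
      (\<Sum>i\<in>UNIV. ?f (D_ix i)) + (\<Sum>i | \<exists>j. j < i. ?f (P_ix i)) + (\<Sum>i | \<exists>j. i < j. ?f (Q_ix i)) +
      (\<Sum>i | \<exists>j. i < j. ?f (G_ix i)) + (\<Sum>i | \<exists>j. j < i. ?f (H_ix i))"
    unfolding D P Q G H effective_sensitivity_def Let_def
    by (simp add: W_def abs_matrix_entry abs_mult)
  moreover have "sensitivity \<Omega> M S \<omega> X $ r $ s
      = (\<Sum>k=1..M. \<bar>\<omega> k * (W ** S k) $ r $ s\<bar>) + (\<Sum>k\<in>qs_params. ?f k)"
    unfolding sensitivity_entry W_def ..
  ultimately show ?thesis
    by (simp add: sum_qs_params)
qed

lemma effective_sensitivity_le:
  "effective_sensitivity \<Omega> M S \<omega> X $ r $ s \<le> sensitivity \<Omega> M S \<omega> X $ r $ s"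
  by (simp add: sensitivity_split sum_nonneg)

lemma abs_mult_abs_nonneg: "0 \<le> (\<bar>Y\<bar> ** \<bar>Z\<bar>) $ r $ s"
  for Y :: "real^'k^'n" and Z :: "real^'m^'k"
  by (simp add: abs_mult_abs_entry sum_nonneg)

lemma effective_sensitivity_ge:
  fixes \<Omega> :: "'n::{finite,linorder} qs_index \<Rightarrow> real" and X :: "real^'m^'n::{finite,linorder}"
  defines "A \<equiv> qs_matrix \<Omega>"
  defines "W \<equiv> matrix_inv A"
  shows "(\<bar>W\<bar> ** \<bar>lower_part A ** X\<bar>) $ r $ s + (\<bar>W ** lower_part A\<bar> ** \<bar>X\<bar>) $ r $ s +
    (\<bar>W\<bar> ** \<bar>upper_part A ** X\<bar>) $ r $ s + (\<bar>W ** upper_part A\<bar> ** \<bar>X\<bar>) $ r $ s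
    \<le> effective_sensitivity \<Omega> M S \<omega> X $ r $ s"
proof -
  have "0 \<le> (\<bar>W\<bar> ** (\<bar>diag_part A\<bar> ** \<bar>X\<bar>)) $ r $ s"
    by (subst matrix_matrix_mult_def)
       (simp add: abs_diag_part_mult_entry abs_matrix_entry sum_nonneg)
  moreover have "0 \<le> (\<Sum>k=1..M. \<bar>\<omega> k\<bar> * \<bar>W ** S k\<bar> $ r $ s)"
    by (simp add: abs_matrix_entry sum_nonneg)
  ultimately show ?thesis
    by (simp add: effective_sensitivity_def Let_def A_def W_def matrix_mul_assoc)
qed

lemma effective_sensitivity_nonneg: "0 \<le> effective_sensitivity \<Omega> M S \<omega> X $ r $ s"
  by (rule order_trans[OF _ effective_sensitivity_ge]) (intro add_nonneg_nonneg abs_mult_abs_nonneg)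

text \<open>
  For each interior \<open>i\<close> the contributions of \<open>a i\<close> and \<open>b i\<close> together are at most the four triangular
  terms of the effective matrix, and there are at most \<open>n - 2\<close> such \<open>i\<close>.
\<close>
lemma sensitivity_le:
  fixes \<Omega> :: "'n::{finite,linorder} qs_index \<Rightarrow> real" and X :: "real^'m^'n::{finite,linorder}"
  assumes "CARD('n) \<ge> 2"
  shows "sensitivity \<Omega> M S \<omega> X $ r $ s
    \<le> (real CARD('n) - 1) * effective_sensitivity \<Omega> M S \<omega> X $ r $ s"
proof -
  let ?A = "qs_matrix \<Omega>" and ?E = "effective_sensitivity \<Omega> M S \<omega> X $ r $ s"
  let ?I = "{i::'n. (\<exists>j. j < i) \<and> (\<exists>j. i < j)}"
  let ?f = "\<lambda>k. \<bar>(matrix_inv ?A ** param_part ?A k ** X) $ r $ s\<bar>"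
  have "?f (A_ix i) + ?f (B_ix i) \<le> ?E" for i
    using keep_rows_minus_keep_cols_bound[of "matrix_inv ?A" "{i<..}" "lower_part ?A" "{i..}" X r s]
      keep_rows_minus_keep_cols_bound[of "matrix_inv ?A" "{..<i}" "upper_part ?A" "{..i}" X r s]
      effective_sensitivity_ge[of \<Omega> X r s M S \<omega>]
    unfolding param_part_interior by linarith
  then have "(\<Sum>i\<in>?I. ?f (A_ix i)) + (\<Sum>i\<in>?I. ?f (B_ix i)) \<le> real (card ?I) * ?E"
    by (simp add: sum_bounded_above flip: sum.distrib)
  also have "\<dots> \<le> (real CARD('n) - 2) * ?E"
    by (rule mult_right_mono[OF card_interior[OF assms] effective_sensitivity_nonneg])
  finally show ?thesis
    unfolding sensitivity_split by (simp add: algebra_simps)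
qed

section \<open>The two-sided estimate\<close>
theorem theorem5p2:
  fixes A :: "real^'n::{finite,linorder}^'n::{finite,linorder}"
    and X B :: "real^'m^'n::{finite,linorder}"
    and \<Omega> :: "'n qs_index \<Rightarrow> real"
    and M :: nat
    and S :: "nat \<Rightarrow> real^'m^'n::{finite,linorder}"
    and \<omega> :: "nat \<Rightarrow> real"
  assumes "CARD('n) \<ge> 2"
    and "A = qs_matrix \<Omega>"
    and "invertible A"
    and "B = sparse_matrix M S \<omega>"
    and "A ** X = B"
    and "\<forall>i j. X $ i $ j \<noteq> 0"
  shows "(qs_error_sup \<Omega> M S \<omega> X \<longlongrightarrow> cond_qs \<Omega> M S \<omega> X) (at_right 0)
    \<and> ereal (cond_eff A M S \<omega> X) \<le> cond_qs \<Omega> M S \<omega> X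
    \<and> cond_qs \<Omega> M S \<omega> X \<le> ereal ((real CARD('n) - 1) * cond_eff A M S \<omega> X)"
proof -
  let ?N = "sensitivity \<Omega> M S \<omega> X" and ?E = "effective_sensitivity \<Omega> M S \<omega> X"
  obtain i j where "max_norm X = \<bar>X $ i $ j\<bar>"
    by (rule max_norm_attained)
  then have X: "0 < max_norm X"
    using assms(6) by simp
  have lim: "(qs_error_sup \<Omega> M S \<omega> X \<longlongrightarrow> ereal (max_norm ?N / max_norm X)) (at_right 0)"
    using assms by (intro qs_error_sup_tendsto X) simp_all
  then have cond: "cond_qs \<Omega> M S \<omega> X = ereal (max_norm ?N / max_norm X)"
    unfolding cond_qs_def by (intro tendsto_Lim) simp_all
  have "max_norm ?E \<le> max_norm ?N"
    by (rule max_norm_mono)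
       (simp add: effective_sensitivity_nonneg sensitivity_nonneg effective_sensitivity_le)
  moreover have "max_norm ?N \<le> max_norm ((real CARD('n) - 1) *\<^sub>R ?E)"
    using assms(1)
    by (intro max_norm_mono)
       (simp add: sensitivity_nonneg effective_sensitivity_nonneg sensitivity_le abs_mult)
  then have "max_norm ?N \<le> (real CARD('n) - 1) * max_norm ?E"
    using assms(1) by (simp add: max_norm_scaleR)
  ultimately have "max_norm ?E / max_norm X \<le> max_norm ?N / max_norm X"
    and "max_norm ?N / max_norm X \<le> (real CARD('n) - 1) * (max_norm ?E / max_norm X)"
    using X by (auto simp: field_simps)
  then show ?thesis
    using lim unfolding cond assms(2) cond_eff_effective_sensitivity ereal_less_eq by blast
qed

end
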